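(* Let $\mathbf{A}$ be an $n\times n$ real interval matrix with midpoint $A^c$ and radius $A^\Delta$, and suppose $\mathbf{A}$ is an inverse M-matrix. Then $$\min_{A\in\mathbf{A}} A^{-1}=\min\left\{\left(A^c+\operatorname{diag}(z^i)A^\Delta\operatorname{diag}(z^j)\right)^{-1} : i,j=1,\dots,n\right\},$$ $$\max_{A\in\mathbf{A}} A^{-1}=\max\left\{\left(A^c-\operatorname{diag}(z^i)A^\Delta\operatorname{diag}(z^j)\right)^{-1} : i,j=1,\dots,n\right\},$$ where the minima and maxima are understood componentwise and $z^i=(1,\dots,1,-1,1,\dots,1)^T\in\mathbb{R}^n$ has $-1$ in the $i$th entry and $1$ elsewhere.
   Context: Inequalities between matrices are entrywise. For $\underline{A}\le\overline{A}$ in $\mathbb{R}^{n\times n}$, the interval matrix is $\mathbf{A}=\{A\in\mathbb{R}^{n\times n} : \underline{A}\le A\le\overline{A}\}$, with midpoint $A^c=\frac12(\underline{A}+\overline{A})$ and radius $A^\Delta=\frac12(\overline{A}-\underline{A})$. A matrix $M\in\mathbb{R}^{n\times n}$ is an M-matrix if $m_{ij}\le 0$ for all $i\ne j$, $M$ is nonsingular, and $M^{-1}\ge 0$. A matrix $A$ is an inverse M-matrix if it is nonsingular and $A^{-1}$ is an M-matrix; $\mathbf{A}$ is an inverse M-matrix if every $A\in\mathbf{A}$ is. $\operatorname{diag}(z)$ is the diagonal matrix with diagonal entries $z_1,\dots,z_n$. *)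

theory Defs
  imports "HOL-Analysis.Analysis"
begin

(* The library order on real ^ 'n ^ 'n is the entrywise one (less_eq_vec_def). *)

definition M_matrix :: "real ^ 'n ^ 'n \<Rightarrow> bool" where
  "M_matrix M \<longleftrightarrow>
     (\<forall>i j. i \<noteq> j \<longrightarrow> M $ i $ j \<le> 0) \<and> invertible M \<and> 0 \<le> matrix_inv M"

definition inverse_M_matrix :: "real ^ 'n ^ 'n \<Rightarrow> bool" where
  "inverse_M_matrix A \<longleftrightarrow> invertible A \<and> M_matrix (matrix_inv A)"

definition interval_matrix :: "real ^ 'n ^ 'n \<Rightarrow> real ^ 'n ^ 'n \<Rightarrow> (real ^ 'n ^ 'n) set" where
  "interval_matrix lo hi = {A. lo \<le> A \<and> A \<le> hi}"

definition midpoint_matrix :: "real ^ 'n ^ 'n \<Rightarrow> real ^ 'n ^ 'n \<Rightarrow> real ^ 'n ^ 'n" where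
  "midpoint_matrix lo hi = (1/2) *\<^sub>R (lo + hi)"

definition radius_matrix :: "real ^ 'n ^ 'n \<Rightarrow> real ^ 'n ^ 'n \<Rightarrow> real ^ 'n ^ 'n" where
  "radius_matrix lo hi = (1/2) *\<^sub>R (hi - lo)"

definition interval_inverse_M_matrix :: "real ^ 'n ^ 'n \<Rightarrow> real ^ 'n ^ 'n \<Rightarrow> bool" where
  "interval_inverse_M_matrix lo hi \<longleftrightarrow> (\<forall>A \<in> interval_matrix lo hi. inverse_M_matrix A)"

definition diag_matrix :: "real ^ 'n \<Rightarrow> real ^ 'n ^ 'n" where
  "diag_matrix z = (\<chi> i j. if i = j then z $ i else 0)"

definition flip_vec :: "'n \<Rightarrow> real ^ 'n" where
  "flip_vec i = (\<chi> k. if k = i then -1 else 1)"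

(* Componentwise minimum and maximum of a possibly infinite set of matrices, as
   predicates: each entry of M must be attained, possibly by different members
   of S for different entries, so M itself need not belong to S. *)

definition is_componentwise_min :: "(real ^ 'n ^ 'n) set \<Rightarrow> real ^ 'n ^ 'n \<Rightarrow> bool" where
  "is_componentwise_min S M \<longleftrightarrow>
     (\<forall>k l. (\<exists>X\<in>S. X $ k $ l = M $ k $ l) \<and> (\<forall>X\<in>S. M $ k $ l \<le> X $ k $ l))"

definition is_componentwise_max :: "(real ^ 'n ^ 'n) set \<Rightarrow> real ^ 'n ^ 'n \<Rightarrow> bool" where
  "is_componentwise_max S M \<longleftrightarrow>
     (\<forall>k l. (\<exists>X\<in>S. X $ k $ l = M $ k $ l) \<and> (\<forall>X\<in>S. X $ k $ l \<le> M $ k $ l))"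

(* Meaningful for finite nonempty S only. *)

definition componentwise_Min :: "(real ^ 'n ^ 'n) set \<Rightarrow> real ^ 'n ^ 'n" where
  "componentwise_Min S = (\<chi> k l. Min ((\<lambda>X. X $ k $ l) ` S))"

definition componentwise_Max :: "(real ^ 'n ^ 'n) set \<Rightarrow> real ^ 'n ^ 'n" where
  "componentwise_Max S = (\<chi> k l. Max ((\<lambda>X. X $ k $ l) ` S))"

end

theory Submission
  imports Defs
begin

text \<open>For invertible \<open>A\<close> and \<open>B\<close> one has \<open>A\<^sup>-\<^sup>1 - B\<^sup>-\<^sup>1 = A\<^sup>-\<^sup>1 (B - A) B\<^sup>-\<^sup>1\<close>.
  Row \<open>i\<close> of an M-matrix has the signs of \<open>- z\<^sup>i\<close>, and so does its column \<open>i\<close>.  Hence if the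
  entries of \<open>B - A\<close> have the signs of \<open>z\<^sup>i (z\<^sup>j)\<^sup>T\<close>, then every summand of the \<open>(i, j)\<close> entry of
  the right-hand side is nonnegative.  Within the interval, this sign condition holds for all
  \<open>A\<close> when \<open>B\<close> is the vertex \<open>A\<^sup>c + diag(z\<^sup>i) A\<^sup>\<Delta> diag(z\<^sup>j)\<close>, and with \<open>A\<close> and \<open>B\<close> exchanged
  for the opposite vertex; so these two vertices give the extrema of the \<open>(i, j)\<close> entry.\<close>

lemma matrix_inv_left_right:
  fixes A :: "real ^ 'n ^ 'n"
  assumes "invertible A"
  shows "matrix_inv A ** A = mat 1" "A ** matrix_inv A = mat 1"
proof -
  have "\<exists>B. A ** B = mat 1 \<and> B ** A = mat 1"
    using assms by (auto simp: invertible_def)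
  then have "A ** matrix_inv A = mat 1 \<and> matrix_inv A ** A = mat 1"
    unfolding matrix_inv_def by (rule someI_ex)
  then show "matrix_inv A ** A = mat 1" "A ** matrix_inv A = mat 1"
    by auto
qed

lemma matrix_matrix_mult_diff_ldistrib:
  fixes A :: "real ^ 'n ^ 'm"
  shows "A ** (B - C) = A ** B - A ** C"
  by (simp add: matrix_matrix_mult_def vec_eq_iff right_diff_distrib sum_subtractf)

lemma matrix_matrix_mult_diff_rdistrib:
  fixes A :: "real ^ 'n ^ 'm"
  shows "(A - B) ** C = A ** C - B ** C"
  by (simp add: matrix_matrix_mult_def vec_eq_iff left_diff_distrib sum_subtractf)

lemma matrix_inv_diff:
  fixes A B :: "real ^ 'n ^ 'n"
  assumes "invertible A" "invertible B"
  shows "matrix_inv A - matrix_inv B = matrix_inv A ** (B - A) ** matrix_inv B"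
proof -
  have "matrix_inv A ** (B - A) ** matrix_inv B
      = matrix_inv A ** (B ** matrix_inv B) - (matrix_inv A ** A) ** matrix_inv B"
    by (simp add: matrix_matrix_mult_diff_ldistrib matrix_matrix_mult_diff_rdistrib matrix_mul_assoc)
  then show ?thesis
    using assms by (simp add: matrix_inv_left_right)
qed

lemma matrix_mult3_nth:
  fixes A B C :: "real ^ 'n ^ 'n"
  shows "(A ** B ** C) $ i $ j = (\<Sum>l\<in>UNIV. \<Sum>k\<in>UNIV. A $ i $ k * B $ k $ l * C $ l $ j)"
  by (simp add: matrix_matrix_mult_def sum_distrib_right)

lemma diag_matrix_mult_nth:
  fixes A :: "real ^ 'n ^ 'n"
  shows "(diag_matrix z ** A ** diag_matrix w) $ k $ l = z $ k * A $ k $ l * w $ l"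
  by (simp add: matrix_matrix_mult_def diag_matrix_def if_distrib [of "\<lambda>x. x * _"]
      if_distrib [of "\<lambda>x. _ * x"] cong: if_cong)

text \<open>The definition of an M-matrix constrains only off-diagonal signs. A negative diagonal
  entry would make row \<open>i\<close> of \<open>M\<close> nonpositive; against the nonnegative
  column \<open>i\<close> of the inverse it would give a product \<le> 0 instead of 1.\<close>

lemma M_matrix_diag_nonneg:
  fixes M :: "real ^ 'n ^ 'n"
  assumes "M_matrix M"
  shows "0 \<le> M $ i $ i"
proof (rule ccontr)
  assume neg: "\<not> 0 \<le> M $ i $ i"
  have "M $ i $ k * matrix_inv M $ k $ i \<le> 0" for k
  proof -
    have "M $ i $ k \<le> 0"
      using assms neg by (cases "k = i") (auto simp: M_matrix_def)
    moreover have "0 \<le> matrix_inv M $ k $ i"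
      using assms by (simp add: M_matrix_def less_eq_vec_def)
    ultimately show ?thesis
      by (rule mult_nonpos_nonneg)
  qed
  then have "(M ** matrix_inv M) $ i $ i \<le> 0"
    by (simp add: matrix_matrix_mult_def sum_nonpos)
  moreover have "M ** matrix_inv M = mat 1"
    using assms by (simp add: M_matrix_def matrix_inv_left_right)
  ultimately show False
    by (simp add: mat_def)
qed

lemma M_matrix_flip_vec_nonpos:
  fixes M :: "real ^ 'n ^ 'n"
  assumes "M_matrix M"
  shows "flip_vec i $ k * M $ i $ k \<le> 0" "flip_vec i $ k * M $ k $ i \<le> 0"
  using assms M_matrix_diag_nonneg [OF assms, of i]
  by (auto simp: flip_vec_def M_matrix_def)

lemma flip_vec_square: "flip_vec i $ k * flip_vec i $ k = 1"
  by (simp add: flip_vec_def)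

lemma inverse_M_matrix_entry_antimono:
  fixes A B :: "real ^ 'n ^ 'n"
  assumes A: "inverse_M_matrix A" and B: "inverse_M_matrix B"
    and le: "\<And>k l. 0 \<le> flip_vec i $ k * flip_vec j $ l * (B $ k $ l - A $ k $ l)"
  shows "matrix_inv B $ i $ j \<le> matrix_inv A $ i $ j"
proof -
  let ?X = "matrix_inv A" and ?Y = "matrix_inv B"
  have "0 \<le> ?X $ i $ k * (B - A) $ k $ l * ?Y $ l $ j" for k l
  proof -
    have "0 \<le> (flip_vec i $ k * ?X $ i $ k) * (flip_vec j $ l * ?Y $ l $ j)"
      using A B by (intro mult_nonpos_nonpos M_matrix_flip_vec_nonpos)
        (auto simp: inverse_M_matrix_def)
    then have "0 \<le> (flip_vec i $ k * ?X $ i $ k) * (flip_vec j $ l * ?Y $ l $ j)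
        * (flip_vec i $ k * flip_vec j $ l * (B $ k $ l - A $ k $ l))"
      using le by (rule mult_nonneg_nonneg)
    \<comment> \<open>Each sign occurs twice, once beside an inverse and once beside
      \<open>B - A\<close>, so all signs cancel and the plain summand remains.\<close>
    also have "\<dots> = (flip_vec i $ k * flip_vec i $ k) * (flip_vec j $ l * flip_vec j $ l)
        * (?X $ i $ k * (B - A) $ k $ l * ?Y $ l $ j)"
      by (simp add: mult_ac)
    finally show ?thesis
      by (simp only: flip_vec_square mult_1)
  qed
  then have "0 \<le> (?X ** (B - A) ** ?Y) $ i $ j"
    unfolding matrix_mult3_nth by (intro sum_nonneg)
  also have "?X ** (B - A) ** ?Y = ?X - ?Y"
    using A B by (simp add: matrix_inv_diff inverse_M_matrix_def)
  finally show ?thesis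
    by simp
qed

text \<open>With s = \<plusminus>1 the product of the two signs, c and r the midpoint and radius
  entries and a that of \<open>A\<close>, the entry of \<open>V\<close> is s r. The two expressions
  become r - s (a - c) and r + s (a - c), and |a - c| \<le> r.\<close>

lemma vertex_bounds:
  fixes lo hi A :: "real ^ 'n ^ 'n" and i j :: 'n
  defines "V \<equiv> diag_matrix (flip_vec i) ** radius_matrix lo hi ** diag_matrix (flip_vec j)"
  assumes "A \<in> interval_matrix lo hi"
  shows "0 \<le> flip_vec i $ k * flip_vec j $ l * ((midpoint_matrix lo hi + V) $ k $ l - A $ k $ l)"
    and "0 \<le> flip_vec i $ k * flip_vec j $ l * (A $ k $ l - (midpoint_matrix lo hi - V) $ k $ l)"
proof -
  have "lo $ k $ l \<le> A $ k $ l" "A $ k $ l \<le> hi $ k $ l"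
    using assms(2) by (simp_all add: interval_matrix_def less_eq_vec_def)
  then show
    "0 \<le> flip_vec i $ k * flip_vec j $ l * ((midpoint_matrix lo hi + V) $ k $ l - A $ k $ l)"
    "0 \<le> flip_vec i $ k * flip_vec j $ l * (A $ k $ l - (midpoint_matrix lo hi - V) $ k $ l)"
    by (auto simp: V_def diag_matrix_mult_nth midpoint_matrix_def radius_matrix_def
        flip_vec_def field_simps)
qed

text \<open>Entries of \<open>V\<close> are plus or minus the radius, so each entry of a vertex is
  an endpoint, that of \<open>lo\<close> or of \<open>hi\<close>.\<close>

lemma vertex_in_interval_matrix:
  fixes lo hi :: "real ^ 'n ^ 'n" and i j :: 'n
  defines "V \<equiv> diag_matrix (flip_vec i) ** radius_matrix lo hi ** diag_matrix (flip_vec j)"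
  assumes "lo \<le> hi"
  shows "midpoint_matrix lo hi + V \<in> interval_matrix lo hi"
    and "midpoint_matrix lo hi - V \<in> interval_matrix lo hi"
proof -
  have "lo $ k $ l \<le> hi $ k $ l" for k l
    using assms(2) by (simp add: less_eq_vec_def)
  then show "midpoint_matrix lo hi + V \<in> interval_matrix lo hi"
    "midpoint_matrix lo hi - V \<in> interval_matrix lo hi"
    by (auto simp: V_def interval_matrix_def less_eq_vec_def diag_matrix_mult_nth
        midpoint_matrix_def radius_matrix_def flip_vec_def field_simps)
qed

text \<open>Passes from the infinite \<open>S\<close> to a finite \<open>T\<close>: a member of
  \<open>T\<close> that is least in \<open>S\<close> at some entry is also least in \<open>T\<close>
  there, hence equals the \<open>Min\<close>. The member may vary with the entry.\<close>

lemma is_componentwise_min_componentwise_Min: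
  fixes S T :: "(real ^ 'n ^ 'n) set"
  assumes "finite T" "T \<subseteq> S"
    and least: "\<And>k l. \<exists>X\<in>T. \<forall>Y\<in>S. X $ k $ l \<le> Y $ k $ l"
  shows "is_componentwise_min S (componentwise_Min T)"
  unfolding is_componentwise_min_def
proof (intro allI)
  fix k l
  obtain X where X: "X \<in> T" "\<forall>Y\<in>S. X $ k $ l \<le> Y $ k $ l"
    using least by blast
  then have "componentwise_Min T $ k $ l = X $ k $ l"
    using assms(1,2) by (auto simp: componentwise_Min_def intro!: Min_eqI)
  then show "(\<exists>X\<in>S. X $ k $ l = componentwise_Min T $ k $ l)
      \<and> (\<forall>X\<in>S. componentwise_Min T $ k $ l \<le> X $ k $ l)"
    using X assms(2) by auto
qed

lemma is_componentwise_max_componentwise_Max: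
  fixes S T :: "(real ^ 'n ^ 'n) set"
  assumes "finite T" "T \<subseteq> S"
    and greatest: "\<And>k l. \<exists>X\<in>T. \<forall>Y\<in>S. Y $ k $ l \<le> X $ k $ l"
  shows "is_componentwise_max S (componentwise_Max T)"
  unfolding is_componentwise_max_def
proof (intro allI)
  fix k l
  obtain X where X: "X \<in> T" "\<forall>Y\<in>S. Y $ k $ l \<le> X $ k $ l"
    using greatest by blast
  then have "componentwise_Max T $ k $ l = X $ k $ l"
    using assms(1,2) by (auto simp: componentwise_Max_def intro!: Max_eqI)
  then show "(\<exists>X\<in>S. X $ k $ l = componentwise_Max T $ k $ l)
      \<and> (\<forall>X\<in>S. X $ k $ l \<le> componentwise_Max T $ k $ l)"
    using X assms(2) by auto
qed

theorem theorem24: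
  fixes lo hi :: "real ^ 'n ^ 'n"
  assumes "lo \<le> hi"
    and "interval_inverse_M_matrix lo hi"
  shows "is_componentwise_min {matrix_inv A | A. A \<in> interval_matrix lo hi}
           (componentwise_Min
             {matrix_inv (midpoint_matrix lo hi
                + diag_matrix (flip_vec i) ** radius_matrix lo hi ** diag_matrix (flip_vec j))
              | i j. True})
       \<and> is_componentwise_max {matrix_inv A | A. A \<in> interval_matrix lo hi}
           (componentwise_Max
             {matrix_inv (midpoint_matrix lo hi
                - diag_matrix (flip_vec i) ** radius_matrix lo hi ** diag_matrix (flip_vec j))
              | i j. True})"
proof -
  define V :: "'n \<Rightarrow> 'n \<Rightarrow> real ^ 'n ^ 'n" where
    "V i j = diag_matrix (flip_vec i) ** radius_matrix lo hi ** diag_matrix (flip_vec j)" for i j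
  let ?c = "midpoint_matrix lo hi"
  let ?S = "{matrix_inv A | A. A \<in> interval_matrix lo hi}"
  have V_in: "?c + V i j \<in> interval_matrix lo hi" "?c - V i j \<in> interval_matrix lo hi" for i j
    unfolding V_def using assms(1) by (rule vertex_in_interval_matrix)+
  have inv: "inverse_M_matrix A" if "A \<in> interval_matrix lo hi" for A
    using assms(2) that by (simp add: interval_inverse_M_matrix_def)
  have lower: "matrix_inv (?c + V i j) $ i $ j \<le> matrix_inv A $ i $ j"
    and upper: "matrix_inv A $ i $ j \<le> matrix_inv (?c - V i j) $ i $ j"
    if "A \<in> interval_matrix lo hi" for A i j
    \<comment> \<open>For \<open>lower\<close> the vertex is the \<open>B\<close> of the
      antimonotonicity lemma; for \<open>upper\<close> it is the \<open>A\<close>.\<close>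
    using vertex_bounds [OF that, of i _ j, folded V_def]
    by (auto intro!: inverse_M_matrix_entry_antimono inv V_in that)
  have fin: "finite {f i j | i j. True}" for f :: "'n \<Rightarrow> 'n \<Rightarrow> real ^ 'n ^ 'n"
    by (rule finite_subset [of _ "range (case_prod f)"]) auto
  have "is_componentwise_min ?S (componentwise_Min {matrix_inv (?c + V i j) | i j. True})"
    \<comment> \<open>The witness for entry \<open>(k, l)\<close> is the inverse of the vertex with
      \<open>i = k\<close> and \<open>j = l\<close>.\<close>
    by (rule is_componentwise_min_componentwise_Min [OF fin]) (use V_in lower in blast)+
  moreover
  have "is_componentwise_max ?S (componentwise_Max {matrix_inv (?c - V i j) | i j. True})"
    by (rule is_componentwise_max_componentwise_Max [OF fin]) (use V_in upper in blast)+
  ultimately show ?thesis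
    unfolding V_def by blast
qed

end
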